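(* There is a constant $b_0>0$ such that for every real $b>b_0$ the following holds. Let $\mathbb{R}^4$ have coordinates $(x_1,x_2,y_1,y_2)$, let $h=\sum_{i=1}^2\left[(dx_i)^2+(dy_i)^2\right]$ be the Euclidean metric, let $\zeta=2$, and let $$f(x_1,x_2,y_1,y_2)=\tfrac12\left[-(x_1)^2-b(x_2)^2+(y_1)^2+(y_2)^2\right].$$ Then the Morse spacetime $(\mathbb{R}^4,h,f,\zeta=2)$ is causally discontinuous (i.e. not causally continuous). More precisely, the points $$q=(\sqrt2+1,0,1,0),\qquad p=(-(\sqrt2-1),0,1,0)$$ are points of causal discontinuity.
   Context: The Morse–Lorentzian metric of the Morse spacetime $(\mathbb{R}^4,h,f,\zeta)$ is the symmetric bilinear form field $g(z)=\|df(z)\|_h^2\,h(z)-\zeta\,df(z)\otimes df(z)$. It vanishes exactly at the critical point $0$ of $f$ and is Lorentzian elsewhere (since $\zeta>1$). At $z\neq 0$, a tangent vector $v$ is timelike if $g(v,v)<0$; it is positively (future) oriented if moreover $df(v)>0$ and negatively (past) oriented if $df(v)<0$. (Equivalently, $v$ is positive timelike iff $v\ne0$ and its Euclidean angle with $\nabla f$ is less than $\theta$, where $\cos\theta=\zeta^{-1/2}$, so $\theta=\pi/4$ for $\zeta=2$.) No vector at $0$ is timelike. A positive (negative) timelike curve is a regular curve avoiding the critical point whose velocity is positive (negative) timelike at every time. A broken positive (negative) timelike curve is a continuous concatenation of finitely many pieces, each of which is positive (negative) timelike except that its endpoints may be the critical point, where a piece ending at the critical point may be followed by a piece starting at the critical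 point. The (broken) future $I^+(z)$ (past $I^-(z)$) is the set of points that can be reached from $z$ by a broken positive (negative) timelike curve. The spacetime is distinguishing if $I^+(p)=I^+(q)$ or $I^-(p)=I^-(q)$ implies $p=q$. It is reflecting if for all points $p,q$: $I^+(p)\subseteq I^+(q)\Leftrightarrow I^-(q)\subseteq I^-(p)$. It is causally continuous if it is distinguishing and reflecting. Two points $p,q$ are called points of causal discontinuity if they violate reflectivity, i.e. if the equivalence $I^+(p)\subseteq I^+(q)\Leftrightarrow I^-(q)\subseteq I^-(p)$ fails for them. *)

theory Defs
  imports "HOL-Analysis.Analysis"
begin

lemma vector_4 [simp]:
  "(vector [a, b, c, d] :: ('a::zero)^4) $ 1 = a"
  "(vector [a, b, c, d] :: ('a::zero)^4) $ 2 = b"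
  "(vector [a, b, c, d] :: ('a::zero)^4) $ 3 = c"
  "(vector [a, b, c, d] :: ('a::zero)^4) $ 4 = d"
  unfolding vector_def by simp_all

text \<open>
  The underlying Riemannian metric \<open>h\<close> is the Euclidean one, i.e. the inner product of the ambient
  type, and tangent vectors are elements of that type. A Morse spacetime is therefore given by the
  function \<open>f\<close> and the parameter \<open>\<zeta>\<close> (with \<open>\<zeta> > 1\<close> in all uses).
\<close>

abbreviation df :: "('a::euclidean_space \<Rightarrow> real) \<Rightarrow> 'a \<Rightarrow> 'a \<Rightarrow> real"
  where "df f z \<equiv> frechet_derivative f (at z)"

definition critical_point :: "('a::euclidean_space \<Rightarrow> real) \<Rightarrow> 'a \<Rightarrow> bool"
  where "critical_point f z \<longleftrightarrow> (\<forall>v. df f z v = 0)"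

(* The norm of the covector df(z) is its dual norm with respect to h, i.e. its operator norm. *)
definition morse_metric :: "('a::euclidean_space \<Rightarrow> real) \<Rightarrow> real \<Rightarrow> 'a \<Rightarrow> 'a \<Rightarrow> 'a \<Rightarrow> real"
  where "morse_metric f \<zeta> z v w = (onorm (df f z))\<^sup>2 * (v \<bullet> w) - \<zeta> * (df f z v * df f z w)"

definition timelike :: "('a::euclidean_space \<Rightarrow> real) \<Rightarrow> real \<Rightarrow> 'a \<Rightarrow> 'a \<Rightarrow> bool"
  where "timelike f \<zeta> z v \<longleftrightarrow> morse_metric f \<zeta> z v v < 0"

definition positive_timelike :: "('a::euclidean_space \<Rightarrow> real) \<Rightarrow> real \<Rightarrow> 'a \<Rightarrow> 'a \<Rightarrow> bool"
  where "positive_timelike f \<zeta> z v \<longleftrightarrow> timelike f \<zeta> z v \<and> df f z v > 0"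

definition negative_timelike :: "('a::euclidean_space \<Rightarrow> real) \<Rightarrow> real \<Rightarrow> 'a \<Rightarrow> 'a \<Rightarrow> bool"
  where "negative_timelike f \<zeta> z v \<longleftrightarrow> timelike f \<zeta> z v \<and> df f z v < 0"

text \<open>
  A piece of a broken curve, with velocities in the cone field \<open>C\<close>. It is a regular (i.e.\ \<open>C\<^sup>1\<close>
  with non-vanishing velocity) curve that avoids the critical points, except that an endpoint may
  be critical; there only continuity is required. At non-critical endpoints the
  velocity is one-sided, so consecutive pieces need not fit together differentiably.
\<close>

definition curve_piece ::
  "('a::euclidean_space \<Rightarrow> real) \<Rightarrow> ('a \<Rightarrow> 'a \<Rightarrow> bool) \<Rightarrow> (real \<Rightarrow> 'a) \<Rightarrow> real \<Rightarrow> real \<Rightarrow> bool"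
  where "curve_piece f C \<gamma> s t \<longleftrightarrow>
    s < t \<and> continuous_on {s..t} \<gamma> \<and>
    (\<forall>u\<in>{s<..<t}. \<not> critical_point f (\<gamma> u)) \<and>
    (\<exists>\<gamma>'. continuous_on {u\<in>{s..t}. \<not> critical_point f (\<gamma> u)} \<gamma>' \<and>
      (\<forall>u\<in>{u\<in>{s..t}. \<not> critical_point f (\<gamma> u)}.
        (\<gamma> has_vector_derivative \<gamma>' u) (at u within {s..t}) \<and>
        \<gamma>' u \<noteq> 0 \<and> C (\<gamma> u) (\<gamma>' u)))"

(* Continuity at the break points r i is part of the continuity of each piece on its closed
   parameter interval. *)
definition broken_curve ::
  "('a::euclidean_space \<Rightarrow> real) \<Rightarrow> ('a \<Rightarrow> 'a \<Rightarrow> bool) \<Rightarrow> (real \<Rightarrow> 'a) \<Rightarrow> real \<Rightarrow> real \<Rightarrow> bool"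
  where "broken_curve f C \<gamma> s t \<longleftrightarrow>
    (\<exists>n\<ge>1. \<exists>r :: nat \<Rightarrow> real. r 0 = s \<and> r n = t \<and>
      (\<forall>i<n. curve_piece f C \<gamma> (r i) (r (Suc i))))"

definition chron_future :: "('a::euclidean_space \<Rightarrow> real) \<Rightarrow> real \<Rightarrow> 'a \<Rightarrow> 'a set"
  where "chron_future f \<zeta> z =
    {w. \<exists>\<gamma> s t. broken_curve f (positive_timelike f \<zeta>) \<gamma> s t \<and> \<gamma> s = z \<and> \<gamma> t = w}"

definition chron_past :: "('a::euclidean_space \<Rightarrow> real) \<Rightarrow> real \<Rightarrow> 'a \<Rightarrow> 'a set"
  where "chron_past f \<zeta> z =
    {w. \<exists>\<gamma> s t. broken_curve f (negative_timelike f \<zeta>) \<gamma> s t \<and> \<gamma> s = z \<and> \<gamma> t = w}"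

definition distinguishing :: "('a::euclidean_space \<Rightarrow> real) \<Rightarrow> real \<Rightarrow> bool"
  where "distinguishing f \<zeta> \<longleftrightarrow>
    (\<forall>p q. chron_future f \<zeta> p = chron_future f \<zeta> q \<or> chron_past f \<zeta> p = chron_past f \<zeta> q
      \<longrightarrow> p = q)"

definition reflecting :: "('a::euclidean_space \<Rightarrow> real) \<Rightarrow> real \<Rightarrow> bool"
  where "reflecting f \<zeta> \<longleftrightarrow>
    (\<forall>p q. chron_future f \<zeta> p \<subseteq> chron_future f \<zeta> q \<longleftrightarrow> chron_past f \<zeta> q \<subseteq> chron_past f \<zeta> p)"

definition causally_continuous :: "('a::euclidean_space \<Rightarrow> real) \<Rightarrow> real \<Rightarrow> bool"
  where "causally_continuous f \<zeta> \<longleftrightarrow> distinguishing f \<zeta> \<and> reflecting f \<zeta>"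

(* Not symmetric in p and q. *)
definition points_of_causal_discontinuity ::
  "('a::euclidean_space \<Rightarrow> real) \<Rightarrow> real \<Rightarrow> 'a \<Rightarrow> 'a \<Rightarrow> bool"
  where "points_of_causal_discontinuity f \<zeta> p q \<longleftrightarrow>
    \<not> (chron_future f \<zeta> p \<subseteq> chron_future f \<zeta> q \<longleftrightarrow> chron_past f \<zeta> q \<subseteq> chron_past f \<zeta> p)"

text \<open>The coordinates \<open>(x\<^sub>1, x\<^sub>2, y\<^sub>1, y\<^sub>2)\<close> are the components 1, 2, 3, 4.\<close>

definition saddle :: "real \<Rightarrow> real^4 \<Rightarrow> real"
  where "saddle b z = 1/2 * (- (z$1)\<^sup>2 - b * (z$2)\<^sup>2 + (z$3)\<^sup>2 + (z$4)\<^sup>2)"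

end

theory Submission
  imports Defs
begin

text \<open>
  In the plane \<open>x\<^sub>2 = y\<^sub>2 = 0\<close> the saddle is \<open>(y\<^sup>2 - x\<^sup>2) / 2\<close> and the light cones have
  half-angle \<open>\<pi>/4\<close>, so \<open>f + x y\<close> and \<open>f - x y\<close> are null coordinates, both strictly increasing along
  positive timelike curves. The points \<open>q\<close> and \<open>p\<close> both have \<open>f + x y = 0\<close>: the null line leaving \<open>q\<close>
  towards the future runs straight into the critical point, and another null line leaves the
  critical point through \<open>p\<close>. Pushing a curve off these lines to the side \<open>f + x y > 0\<close> gets it past
  the critical point, whereas on the side \<open>f + x y < 0\<close> it must cross the line \<open>x = 0\<close> where \<open>f < 0\<close>,
  and in the plane there is no such point. That is the asymmetry behind the theorem, and what has
  to be shown is that the two additional dimensions do not remove it. The proof works for \<open>b > 6\<close>.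

  \<^emph>\<open>The future of \<open>p\<close> lies in the future of \<open>q\<close>.\<close> The arcs \<open>c / (s + c) \<cdot> q + s \<cdot> p\<close> of hyperbolas,
  with \<open>s\<close> running from \<open>0\<close> to \<open>1\<close>, are positive timelike curves from \<open>q\<close> whose endpoints
  tend to \<open>p\<close> as \<open>c\<close> tends to \<open>0\<close> (\<open>hyperbola_joins\<close>). The cones are open, so the past of any point
  in the future of \<open>p\<close> contains a neighbourhood of \<open>p\<close> (\<open>past_is_neighbourhood\<close>) and hence the
  endpoint of such an arc.

  \<^emph>\<open>The past of \<open>q\<close> does not lie in the past of \<open>p\<close>.\<close> The function \<open>f + x\<^sub>1 y\<^sub>1\<close> on all of four-space
  strictly decreases along negative timelike curves (\<open>null_coord_decreases\<close>): its gradient is that of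
  \<open>f\<close> plus an orthogonal vector that is no longer, so it encloses an angle of at most \<open>\<pi>/4\<close> with it.
  As it vanishes at \<open>p\<close> and at the critical point, it is negative
  on the past of \<open>p\<close>, which therefore omits the critical point. A curve in this past that starts
  at \<open>p\<close>, where \<open>x\<^sub>1 < 0\<close>, and reaches \<open>x\<^sub>1 > 0\<close> must meet \<open>x\<^sub>1 = 0\<close> at a point with \<open>f < 0\<close>, that is, with
  \<open>b x\<^sub>2\<^sup>2 > y\<^sub>1\<^sup>2 + y\<^sub>2\<^sup>2\<close>. There it is inside the double cone \<open>b x\<^sub>2\<^sup>2 > x\<^sub>1\<^sup>2 + y\<^sub>1\<^sup>2 + y\<^sub>2\<^sup>2\<close> around the
  \<open>x\<^sub>2\<close>-axis. For large \<open>b\<close> the gradient of \<open>f\<close> is so steep in the direction of \<open>x\<^sub>2\<close> that negative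
  timelike curves cannot leave this cone (\<open>x2_cone_form_increases\<close>). So every point of the past of \<open>p\<close>
  has \<open>x\<^sub>1 < 0\<close> or lies in the cone (\<open>past_trapped\<close>), while \<open>q + (1, 0, 0, 0)\<close>, which lies in the past
  of \<open>q\<close>, satisfies neither condition.
\<close>

section \<open>Chronology as a transitive closure\<close>

text \<open>
  Forgetting the parametrisation turns the concatenation of pieces into the transitive closure of
  this relation, and invariants of broken curves into rule inductions.
\<close>

definition joined_by_piece ::
  "('a::euclidean_space \<Rightarrow> real) \<Rightarrow> ('a \<Rightarrow> 'a \<Rightarrow> bool) \<Rightarrow> 'a \<Rightarrow> 'a \<Rightarrow> bool"
  where "joined_by_piece f C z w \<longleftrightarrow> (\<exists>\<gamma> s t. curve_piece f C \<gamma> s t \<and> \<gamma> s = z \<and> \<gamma> t = w)"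

lemma curve_piece_cong:
  assumes "curve_piece f C \<gamma> s t" and eq: "\<And>u. u \<in> {s..t} \<Longrightarrow> \<delta> u = \<gamma> u"
  shows "curve_piece f C \<delta> s t"
proof -
  from assms(1) obtain \<gamma>' where st: "s < t" and c: "continuous_on {s..t} \<gamma>"
    and n: "\<forall>u\<in>{s<..<t}. \<not> critical_point f (\<gamma> u)"
    and c': "continuous_on {u\<in>{s..t}. \<not> critical_point f (\<gamma> u)} \<gamma>'"
    and d: "\<forall>u\<in>{u\<in>{s..t}. \<not> critical_point f (\<gamma> u)}.
        (\<gamma> has_vector_derivative \<gamma>' u) (at u within {s..t}) \<and> \<gamma>' u \<noteq> 0 \<and> C (\<gamma> u) (\<gamma>' u)"
    unfolding curve_piece_def by blast
  have set_eq: "{u\<in>{s..t}. \<not> critical_point f (\<delta> u)} = {u\<in>{s..t}. \<not> critical_point f (\<gamma> u)}"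
    using eq by auto
  have "continuous_on {s..t} \<delta>"
    using c eq continuous_on_cong by (metis (no_types, lifting))
  moreover have "(\<delta> has_vector_derivative \<gamma>' u) (at u within {s..t})"
    if "u \<in> {s..t}" "\<not> critical_point f (\<gamma> u)" for u
    using has_vector_derivative_transform[of u "{s..t}" \<delta> \<gamma>] d that eq by blast
  ultimately show ?thesis
    unfolding curve_piece_def set_eq using st n c' d eq by (intro conjI exI[of _ \<gamma>']) auto
qed

lemma curve_piece_shift:
  assumes "curve_piece f C \<gamma> s t"
  shows "curve_piece f C (\<lambda>u. \<gamma> (u + c)) (s - c) (t - c)"
proof -
  from assms obtain \<gamma>' where st: "s < t" and co: "continuous_on {s..t} \<gamma>"
    and n: "\<forall>u\<in>{s<..<t}. \<not> critical_point f (\<gamma> u)"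
    and c': "continuous_on {u\<in>{s..t}. \<not> critical_point f (\<gamma> u)} \<gamma>'"
    and d: "\<forall>u\<in>{u\<in>{s..t}. \<not> critical_point f (\<gamma> u)}.
        (\<gamma> has_vector_derivative \<gamma>' u) (at u within {s..t}) \<and> \<gamma>' u \<noteq> 0 \<and> C (\<gamma> u) (\<gamma>' u)"
    unfolding curve_piece_def by blast
  have im: "(\<lambda>u. u + c) ` {s - c..t - c} = {s..t}"
    by simp
  have "continuous_on {s - c..t - c} (\<lambda>u. \<gamma> (u + c))"
    by (rule continuous_on_compose2[OF co]) (auto intro!: continuous_intros)
  moreover have "continuous_on {u\<in>{s - c..t - c}. \<not> critical_point f (\<gamma> (u + c))} (\<lambda>u. \<gamma>' (u + c))"
    by (rule continuous_on_compose2[OF c']) (auto intro!: continuous_intros)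
  moreover have "((\<lambda>u. \<gamma> (u + c)) has_vector_derivative \<gamma>' (u + c)) (at u within {s - c..t - c})"
    if "u \<in> {s - c..t - c}" "\<not> critical_point f (\<gamma> (u + c))" for u
  proof -
    have "((\<lambda>u. u + c) has_vector_derivative 1) (at u within {s - c..t - c})"
      by (auto intro!: derivative_eq_intros)
    moreover have "(\<gamma> has_vector_derivative \<gamma>' (u + c)) (at (u + c) within (\<lambda>u. u + c) ` {s - c..t - c})"
      unfolding im using d that by auto
    ultimately show ?thesis
      using vector_diff_chain_within[of "\<lambda>u. u + c" 1 u "{s - c..t - c}" \<gamma>]
      by (simp add: o_def)
  qed
  ultimately show ?thesis
    unfolding curve_piece_def using st n d
    by (intro conjI exI[of _ "\<lambda>u. \<gamma>' (u + c)"]) auto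
qed

lemma curve_piece_restrict:
  assumes "curve_piece f C \<gamma> s t" "s \<le> a" "a < b" "b \<le> t"
  shows "curve_piece f C \<gamma> a b"
proof -
  from assms(1) obtain \<gamma>' where co: "continuous_on {s..t} \<gamma>"
    and n: "\<forall>u\<in>{s<..<t}. \<not> critical_point f (\<gamma> u)"
    and c': "continuous_on {u\<in>{s..t}. \<not> critical_point f (\<gamma> u)} \<gamma>'"
    and d: "\<forall>u\<in>{u\<in>{s..t}. \<not> critical_point f (\<gamma> u)}.
        (\<gamma> has_vector_derivative \<gamma>' u) (at u within {s..t}) \<and> \<gamma>' u \<noteq> 0 \<and> C (\<gamma> u) (\<gamma>' u)"
    unfolding curve_piece_def by blast
  have sub: "{a..b} \<subseteq> {s..t}" using assms by auto
  have "continuous_on {u\<in>{a..b}. \<not> critical_point f (\<gamma> u)} \<gamma>'"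
    by (rule continuous_on_subset[OF c']) (use sub in auto)
  moreover have "(\<gamma> has_vector_derivative \<gamma>' u) (at u within {a..b})"
    if "u \<in> {a..b}" "\<not> critical_point f (\<gamma> u)" for u
    using has_vector_derivative_within_subset[OF _ sub, of \<gamma>] d that sub by blast
  moreover have "\<gamma>' u \<noteq> 0" "C (\<gamma> u) (\<gamma>' u)"
    if "u \<in> {a..b}" "\<not> critical_point f (\<gamma> u)" for u
    using d that sub by blast+
  moreover have "\<forall>u\<in>{a<..<b}. \<not> critical_point f (\<gamma> u)"
    using n assms by auto
  ultimately show ?thesis
    unfolding curve_piece_def using \<open>a < b\<close> continuous_on_subset[OF co sub]
    by (intro conjI exI[of _ \<gamma>']) blast+
qed

lemma broken_curve_imp_tranclp:
  assumes "broken_curve f C \<gamma> s t"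
  shows "(joined_by_piece f C)\<^sup>+\<^sup>+ (\<gamma> s) (\<gamma> t)"
proof -
  from assms obtain n and r :: "nat \<Rightarrow> real" where n: "n \<ge> 1" "r 0 = s" "r n = t"
    and p: "\<And>i. i < n \<Longrightarrow> curve_piece f C \<gamma> (r i) (r (Suc i))"
    unfolding broken_curve_def by blast
  have "(joined_by_piece f C)\<^sup>+\<^sup>+ (\<gamma> (r 0)) (\<gamma> (r (Suc k)))" if "k < n" for k
    using that
  proof (induction k)
    case 0
    then show ?case using p[of 0] by (auto simp: joined_by_piece_def)
  next
    case (Suc k)
    moreover have "joined_by_piece f C (\<gamma> (r (Suc k))) (\<gamma> (r (Suc (Suc k))))"
      using p[of "Suc k"] Suc.prems by (auto simp: joined_by_piece_def)
    ultimately show ?case by (meson Suc_lessD tranclp.trancl_into_trancl)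
  qed
  from this[of "n - 1"] show ?thesis using n by simp
qed

lemma broken_curve_append_piece:
  assumes "broken_curve f C \<gamma> s t" and \<delta>: "curve_piece f C \<delta> a b" and ends: "\<delta> a = \<gamma> t"
  shows "\<exists>\<eta>. broken_curve f C \<eta> s (t + (b - a)) \<and> \<eta> s = \<gamma> s \<and> \<eta> (t + (b - a)) = \<delta> b"
proof -
  from assms(1) obtain n and r :: "nat \<Rightarrow> real" where n: "n \<ge> 1" "r 0 = s" "r n = t"
    and p: "\<And>i. i < n \<Longrightarrow> curve_piece f C \<gamma> (r i) (r (Suc i))"
    unfolding broken_curve_def by blast
  have le_t: "r i \<le> t" if "i \<le> n" for i
    using that
  proof (induction i rule: inc_induct)
    case (step i)
    have "r i < r (Suc i)" using p[OF step.hyps(2)] by (simp add: curve_piece_def)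
    then show ?case using step.IH by simp
  qed (use n in simp)
  have "r 0 < r 1" using p[of 0] n by (simp add: curve_piece_def)
  then have "s < t" using le_t[of 1] n by simp
  have "a < b" using \<delta> by (simp add: curve_piece_def)
  define \<eta> where "\<eta> u = (if u \<le> t then \<gamma> u else \<delta> (u + (a - t)))" for u
  define r' where "r' i = (if i \<le> n then r i else t + (b - a))" for i
  have "curve_piece f C \<eta> (r' i) (r' (Suc i))" if "i < Suc n" for i
  proof (cases "i < n")
    case True
    have "curve_piece f C \<eta> (r i) (r (Suc i))"
      by (rule curve_piece_cong[OF p[OF True]]) (use le_t[of "Suc i"] True in \<open>auto simp: \<eta>_def\<close>)
    then show ?thesis using True by (simp add: r'_def)
  next
    case False
    then have "i = n" using that by simp
    have "curve_piece f C (\<lambda>u. \<delta> (u + (a - t))) t (t + (b - a))"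
      using curve_piece_shift[OF \<delta>, of "a - t"] by (simp add: algebra_simps)
    then have "curve_piece f C \<eta> t (t + (b - a))"
      by (rule curve_piece_cong) (use ends in \<open>auto simp: \<eta>_def\<close>)
    then show ?thesis using \<open>i = n\<close> n by (simp add: r'_def)
  qed
  then have "broken_curve f C \<eta> s (t + (b - a))"
    unfolding broken_curve_def using n
    by (intro exI[of _ "Suc n"] conjI exI[of _ r']) (auto simp: r'_def)
  then show ?thesis
    using \<open>s < t\<close> \<open>a < b\<close> by (intro exI[of _ \<eta>]) (auto simp: \<eta>_def)
qed

lemma broken_curve_iff_tranclp:
  "(\<exists>\<gamma> s t. broken_curve f C \<gamma> s t \<and> \<gamma> s = z \<and> \<gamma> t = w) \<longleftrightarrow> (joined_by_piece f C)\<^sup>+\<^sup>+ z w"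
proof
  assume "\<exists>\<gamma> s t. broken_curve f C \<gamma> s t \<and> \<gamma> s = z \<and> \<gamma> t = w"
  then show "(joined_by_piece f C)\<^sup>+\<^sup>+ z w" using broken_curve_imp_tranclp by blast
next
  assume "(joined_by_piece f C)\<^sup>+\<^sup>+ z w"
  then show "\<exists>\<gamma> s t. broken_curve f C \<gamma> s t \<and> \<gamma> s = z \<and> \<gamma> t = w"
  proof (induction rule: tranclp_induct)
    case (base w)
    then obtain \<gamma> s t where \<gamma>: "curve_piece f C \<gamma> s t" "\<gamma> s = z" "\<gamma> t = w"
      unfolding joined_by_piece_def by blast
    then have "broken_curve f C \<gamma> s t"
      unfolding broken_curve_def
      by (intro exI[of _ "1::nat"] conjI exI[of _ "\<lambda>i::nat. if i = 0 then s else t"]) auto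
    then show ?case using \<gamma> by blast
  next
    case (step w x)
    then obtain \<gamma> s t \<delta> a b where "broken_curve f C \<gamma> s t" "\<gamma> s = z" "\<gamma> t = w"
      and "curve_piece f C \<delta> a b" "\<delta> a = w" "\<delta> b = x"
      unfolding joined_by_piece_def by blast
    then show ?case using broken_curve_append_piece[of f C \<gamma> s t \<delta> a b] by metis
  qed
qed

lemma chron_future_eq:
  "chron_future f \<zeta> z = {w. (joined_by_piece f (positive_timelike f \<zeta>))\<^sup>+\<^sup>+ z w}"
  unfolding chron_future_def broken_curve_iff_tranclp ..

lemma chron_past_eq:
  "chron_past f \<zeta> z = {w. (joined_by_piece f (negative_timelike f \<zeta>))\<^sup>+\<^sup>+ z w}"
  unfolding chron_past_def broken_curve_iff_tranclp ..

section \<open>Open cone fields\<close>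

lemma joined_by_differentiable_curve:
  assumes "s < t"
    and "\<And>u. u \<in> {s..t} \<Longrightarrow> (\<gamma> has_vector_derivative \<gamma>' u) (at u within {s..t})"
    and "continuous_on {s..t} \<gamma>'"
    and "\<And>u. u \<in> {s..t} \<Longrightarrow> C (\<gamma> u) (\<gamma>' u)"
    and cone: "\<And>z v. C z v \<Longrightarrow> \<not> critical_point f z \<and> v \<noteq> 0"
  shows "joined_by_piece f C (\<gamma> s) (\<gamma> t)"
proof -
  have "continuous_on {s..t} \<gamma>"
    using assms(2) by (meson continuous_on_vector_derivative)
  moreover have nc: "\<not> critical_point f (\<gamma> u)" and "\<gamma>' u \<noteq> 0" if "u \<in> {s..t}" for u
    using cone[OF assms(4)[OF that]] by blast+
  moreover have "{u\<in>{s..t}. \<not> critical_point f (\<gamma> u)} = {s..t}"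
    using nc by blast
  ultimately have "curve_piece f C \<gamma> s t"
    unfolding curve_piece_def using assms(1-4)
    by (intro conjI exI[of _ \<gamma>'] ballI) simp_all
  then show ?thesis unfolding joined_by_piece_def by blast
qed

lemma tendsto_difference_quotient:
  assumes "(\<gamma> has_vector_derivative v) (at s within S)"
  shows "((\<lambda>u. (1 / (u - s)) *\<^sub>R (\<gamma> u - \<gamma> s)) \<longlongrightarrow> v) (at s within S)"
proof -
  have "((\<lambda>u. (1 / norm (u - s)) *\<^sub>R (\<gamma> u - (\<gamma> s + (u - s) *\<^sub>R v))) \<longlongrightarrow> 0) (at s within S)"
    using assms by (simp add: has_vector_derivative_def has_derivative_within)
  then have "((\<lambda>u. norm ((1 / norm (u - s)) *\<^sub>R (\<gamma> u - (\<gamma> s + (u - s) *\<^sub>R v)))) \<longlongrightarrow> 0)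
      (at s within S)"
    by (rule tendsto_norm_zero)
  moreover have "\<forall>\<^sub>F u in at s within S.
      norm ((1 / norm (u - s)) *\<^sub>R (\<gamma> u - (\<gamma> s + (u - s) *\<^sub>R v)))
      = norm ((1 / (u - s)) *\<^sub>R (\<gamma> u - \<gamma> s) - v)"
    unfolding eventually_at_filter
  proof (intro always_eventually allI impI)
    fix u assume "u \<noteq> s"
    then have "(1 / (u - s)) *\<^sub>R (\<gamma> u - \<gamma> s) - v = (1 / (u - s)) *\<^sub>R (\<gamma> u - (\<gamma> s + (u - s) *\<^sub>R v))"
      by (simp add: scaleR_diff_right scaleR_add_right)
    then show "norm ((1 / norm (u - s)) *\<^sub>R (\<gamma> u - (\<gamma> s + (u - s) *\<^sub>R v)))
      = norm ((1 / (u - s)) *\<^sub>R (\<gamma> u - \<gamma> s) - v)"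
      by simp
  qed
  ultimately have "((\<lambda>u. norm ((1 / (u - s)) *\<^sub>R (\<gamma> u - \<gamma> s) - v)) \<longlongrightarrow> 0) (at s within S)"
    by (rule Lim_transform_eventually)
  then show ?thesis using tendsto_norm_zero_iff LIM_zero_iff by blast
qed

text \<open>
  The initial velocity of a piece from \<open>z\<close> lies in the open cone at \<open>z\<close>, and a short chord of the
  curve has almost the same direction. A segment from any point sufficiently near \<open>z\<close> to the far
  end of that chord then still has its direction in the cone, so the rest of the curve can be
  joined from there.
\<close>

lemma past_is_neighbourhood:
  assumes "joined_by_piece f C z w" and nc: "\<not> critical_point f z"
    and op: "open {(z, v). C z v}"
    and cone: "\<And>z v. C z v \<Longrightarrow> \<not> critical_point f z \<and> v \<noteq> 0"
    and scale: "\<And>z v a. C z v \<Longrightarrow> 0 < a \<Longrightarrow> C z (a *\<^sub>R v)"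
  shows "\<exists>r>0. \<forall>x\<in>ball z r. (joined_by_piece f C)\<^sup>+\<^sup>+ x w"
proof -
  from assms(1) obtain \<gamma> s t where \<gamma>: "curve_piece f C \<gamma> s t" "\<gamma> s = z" "\<gamma> t = w"
    unfolding joined_by_piece_def by blast
  then obtain \<gamma>' where st: "s < t" and co: "continuous_on {s..t} \<gamma>"
    and d: "\<forall>u\<in>{u\<in>{s..t}. \<not> critical_point f (\<gamma> u)}.
        (\<gamma> has_vector_derivative \<gamma>' u) (at u within {s..t}) \<and> \<gamma>' u \<noteq> 0 \<and> C (\<gamma> u) (\<gamma>' u)"
    unfolding curve_piece_def by blast
  define v where "v = \<gamma>' s"
  have v: "(\<gamma> has_vector_derivative v) (at s within {s..t})" "C z v"
    using d nc st \<gamma> by (auto simp: v_def)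
  have "(z, v) \<in> {(z, v). C z v}"
    using v(2) by simp
  with op obtain A B where AB: "open A" "open B" "(z, v) \<in> A \<times> B" "A \<times> B \<subseteq> {(z, v). C z v}"
    by (rule open_prod_elim)
  obtain r1 where r1: "r1 > 0" "ball z r1 \<subseteq> A" using openE[OF AB(1), of z] AB(3) by blast
  obtain r2 where r2: "r2 > 0" "ball v r2 \<subseteq> B" using openE[OF AB(2), of v] AB(3) by blast
  have CI: "C x y" if "dist z x < r1" "dist v y < r2" for x y
    using that r1(2) r2(2) AB(4) by (metis (no_types, lifting) SigmaI case_prodD mem_Collect_eq mem_ball subsetD)
  have "(\<gamma> \<longlongrightarrow> z) (at s within {s..t})"
    using co st \<gamma> by (auto simp: continuous_on_def)
  then have "\<forall>\<^sub>F u in at s within {s..t}. dist (\<gamma> u) z < r1"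
    using r1 by (simp add: tendsto_iff)
  moreover have "\<forall>\<^sub>F u in at s within {s..t}. dist ((1 / (u - s)) *\<^sub>R (\<gamma> u - z)) v < r2 / 2"
    using tendstoD[OF tendsto_difference_quotient[OF v(1)], of "r2 / 2"] r2(1) \<gamma>(2) by simp
  moreover have "\<forall>\<^sub>F u in at s within {s..t}. u \<in> {s<..<t}"
    using st eventually_at_right_real[of s t] by (simp add: at_within_Icc_at_right)
  ultimately have "\<forall>\<^sub>F u in at s within {s..t}. dist (\<gamma> u) z < r1 \<and>
      dist ((1 / (u - s)) *\<^sub>R (\<gamma> u - z)) v < r2 / 2 \<and> u \<in> {s<..<t}"
    by (simp add: eventually_conj)
  moreover have "at s within {s..t} \<noteq> bot"
    using st by (simp add: at_within_Icc_at_right)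
  ultimately obtain u where u: "dist (\<gamma> u) z < r1"
      "dist ((1 / (u - s)) *\<^sub>R (\<gamma> u - z)) v < r2 / 2" "s < u" "u < t"
    using eventually_happens by fastforce
  have tail: "joined_by_piece f C (\<gamma> u) w"
    unfolding joined_by_piece_def
    using curve_piece_restrict[OF \<gamma>(1), of u t] u \<gamma>(3) by fastforce
  \<comment> \<open>The second radius keeps the change of the difference quotient, which is divided by \<open>u - s\<close>,
    below \<open>r2 / 2\<close> when \<open>z\<close> is replaced by \<open>x\<close>.\<close>
  have straight: "joined_by_piece f C x (\<gamma> u)" if x: "x \<in> ball z (min r1 ((u - s) * (r2 / 2)))" for x
  proof -
    define e where "e = u - s"
    have e: "e > 0" using u by (simp add: e_def)
    have "(1 / e) *\<^sub>R (\<gamma> u - x) - v = ((1 / e) *\<^sub>R (\<gamma> u - z) - v) + (1 / e) *\<^sub>R (z - x)"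
      by (simp add: algebra_simps)
    also have "norm \<dots> \<le> norm ((1 / e) *\<^sub>R (\<gamma> u - z) - v) + norm ((1 / e) *\<^sub>R (z - x))"
      by (rule norm_triangle_ineq)
    also have "norm ((1 / e) *\<^sub>R (z - x)) < r2 / 2"
      using x e by (simp add: dist_norm e_def[symmetric] divide_less_eq mult.commute)
    also have "norm ((1 / e) *\<^sub>R (\<gamma> u - z) - v) < r2 / 2"
      using u(2) by (simp add: dist_norm e_def)
    finally have dir: "dist v ((1 / e) *\<^sub>R (\<gamma> u - x)) < r2"
      by (simp add: dist_norm norm_minus_commute)
    have "C (x + \<tau> *\<^sub>R (\<gamma> u - x)) (\<gamma> u - x)" if "\<tau> \<in> {0..1}" for \<tau>
    proof -
      have "x + \<tau> *\<^sub>R (\<gamma> u - x) = (1 - \<tau>) *\<^sub>R x + \<tau> *\<^sub>R \<gamma> u"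
        by (simp add: algebra_simps)
      also have "\<dots> \<in> ball z r1"
        by (rule convexD[OF convex_ball]) (use x u that in \<open>auto simp: dist_commute\<close>)
      finally have "C (x + \<tau> *\<^sub>R (\<gamma> u - x)) ((1 / e) *\<^sub>R (\<gamma> u - x))"
        using dir by (intro CI) auto
      then have "C (x + \<tau> *\<^sub>R (\<gamma> u - x)) (e *\<^sub>R (1 / e) *\<^sub>R (\<gamma> u - x))"
        using scale e by blast
      then show ?thesis using e by simp
    qed
    then have "joined_by_piece f C (x + 0 *\<^sub>R (\<gamma> u - x)) (x + 1 *\<^sub>R (\<gamma> u - x))"
      by (intro joined_by_differentiable_curve[where \<gamma>' = "\<lambda>_. \<gamma> u - x"] cone)
        (auto intro!: derivative_eq_intros)
    then show ?thesis by simp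
  qed
  have "(joined_by_piece f C)\<^sup>+\<^sup>+ x w" if "x \<in> ball z (min r1 ((u - s) * (r2 / 2)))" for x
    using straight[OF that] tail by (meson tranclp.r_into_trancl tranclp.trancl_into_trancl)
  then show ?thesis
    using r1 r2 u by (intro exI[of _ "min r1 ((u - s) * (r2 / 2))"]) auto
qed

section \<open>Barriers along curve pieces\<close>

lemma curve_piece_has_real_derivative:
  assumes "curve_piece f C \<gamma> s t" "u \<in> {s<..<t}"
    and \<phi>: "(\<phi> has_derivative (\<lambda>v. N \<bullet> v)) (at (\<gamma> u))"
  obtains v where "C (\<gamma> u) v" "((\<lambda>u. \<phi> (\<gamma> u)) has_real_derivative N \<bullet> v) (at u)"
proof -
  from assms obtain v where v: "(\<gamma> has_vector_derivative v) (at u within {s..t})" "C (\<gamma> u) v"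
    unfolding curve_piece_def by fastforce
  then have "(\<gamma> has_derivative (\<lambda>h. h *\<^sub>R v)) (at u)"
    using assms(2) by (simp add: at_within_Icc_at has_vector_derivative_def)
  then have "((\<lambda>u. \<phi> (\<gamma> u)) has_derivative (\<lambda>h. N \<bullet> (h *\<^sub>R v))) (at u)"
    by (rule has_derivative_compose) (rule \<phi>)
  then have "((\<lambda>u. \<phi> (\<gamma> u)) has_real_derivative N \<bullet> v) (at u)"
    by (simp add: has_field_derivative_def mult.commute[of _ "N \<bullet> v"] )
  then show ?thesis using v that by blast
qed

text \<open>
  A first zero would be approached from the left through positive values, that is, while increasing.
\<close>

lemma positive_if_increasing_where_positive:
  fixes g :: "real \<Rightarrow> real"
  assumes "a \<le> b" and co: "continuous_on {a..b} g" and "g a > 0"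
    and deriv: "\<And>u. a < u \<Longrightarrow> u < b \<Longrightarrow> g u > 0 \<Longrightarrow> \<exists>d. (g has_real_derivative d) (at u) \<and> d > 0"
  shows "g b > 0"
proof (rule ccontr)
  assume "\<not> g b > 0"
  define Z where "Z = {a..b} \<inter> g -` {..0}"
  have "closed Z" unfolding Z_def by (rule continuous_closed_preimage[OF co]) auto
  moreover have "b \<in> Z" using \<open>\<not> g b > 0\<close> \<open>a \<le> b\<close> by (simp add: Z_def)
  moreover have bdd: "bdd_below Z" unfolding Z_def by (rule bdd_belowI[of _ a]) auto
  ultimately have Inf: "Inf Z \<in> Z" using closed_contains_Inf by blast
  have before: "g u > 0" if "a \<le> u" "u < Inf Z" for u
  proof (rule ccontr)
    assume "\<not> g u > 0"
    then have "u \<in> Z" using that Inf by (auto simp: Z_def)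
    then show False using cInf_lower[OF _ bdd] that by fastforce
  qed
  have "a \<le> Inf Z" "Inf Z \<noteq> a" using Inf \<open>g a > 0\<close> unfolding Z_def by fastforce+
  then have "a < Inf Z" by simp
  then have "g a < g (Inf Z)"
  proof (rule DERIV_pos_imp_increasing_open)
    show "continuous_on {a..Inf Z} g"
      by (rule continuous_on_subset[OF co]) (use Inf in \<open>auto simp: Z_def\<close>)
    show "\<exists>y. (g has_real_derivative y) (at u) \<and> 0 < y" if "a < u" "u < Inf Z" for u
      using deriv[of u] before[of u] that Inf by (auto simp: Z_def)
  qed
  then show False using Inf \<open>g a > 0\<close> by (simp add: Z_def)
qed

section \<open>The light cones of the saddle\<close>

lemma inner_real4: "(x::real^4) \<bullet> y = x$1 * y$1 + x$2 * y$2 + x$3 * y$3 + x$4 * y$4"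
  by (simp add: inner_vec_def sum_4)

lemma norm_real4_sq: "(norm (x::real^4))\<^sup>2 = (x$1)\<^sup>2 + (x$2)\<^sup>2 + (x$3)\<^sup>2 + (x$4)\<^sup>2"
  unfolding power2_norm_eq_inner inner_real4 by (simp add: power2_eq_square)

lemmas has_derivative_vec_nth [derivative_intros] =
  bounded_linear.has_derivative[OF bounded_linear_vec_nth]

definition saddle_grad :: "real \<Rightarrow> real^4 \<Rightarrow> real^4"
  where "saddle_grad b z = vector [- (z$1), - b * z$2, z$3, z$4]"

lemma df_saddle: "df (saddle b) z = (\<lambda>v. saddle_grad b z \<bullet> v)"
proof -
  have "(saddle b has_derivative (\<lambda>v. saddle_grad b z \<bullet> v)) (at z)"
    unfolding saddle_def
    by (auto intro!: derivative_eq_intros simp: fun_eq_iff inner_real4 saddle_grad_def algebra_simps)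
  then show ?thesis by (rule frechet_derivative_at[symmetric])
qed

lemma critical_point_saddle: "critical_point (saddle b) z \<longleftrightarrow> saddle_grad b z = 0"
  unfolding critical_point_def df_saddle by (metis inner_eq_zero_iff inner_zero_left)

lemma onorm_inner: "onorm (\<lambda>v. (g::'a::euclidean_space) \<bullet> v) = norm g"
proof (rule antisym)
  show "onorm (\<lambda>v. g \<bullet> v) \<le> norm g"
    by (rule onorm_le) (simp add: Cauchy_Schwarz_ineq2)
  have "norm g * norm g \<le> onorm (\<lambda>v. g \<bullet> v) * norm g"
    using onorm[OF bounded_linear_inner_right, of g g]
    by (simp add: power2_norm_eq_inner[symmetric] power2_eq_square)
  then show "norm g \<le> onorm (\<lambda>v. g \<bullet> v)"
    using onorm_pos_le[OF bounded_linear_inner_right, of g] by (cases "norm g = 0") auto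
qed

lemma timelike_saddle:
  "timelike (saddle b) 2 z v \<longleftrightarrow>
    (norm (saddle_grad b z))\<^sup>2 * (norm v)\<^sup>2 < 2 * (saddle_grad b z \<bullet> v)\<^sup>2"
  unfolding timelike_def morse_metric_def df_saddle onorm_inner
  by (simp add: power2_norm_eq_inner[of v] power2_eq_square[of "_ \<bullet> _"])

lemma positive_timelike_saddle:
  "positive_timelike (saddle b) 2 z v \<longleftrightarrow>
    (norm (saddle_grad b z))\<^sup>2 * (norm v)\<^sup>2 < 2 * (saddle_grad b z \<bullet> v)\<^sup>2 \<and> saddle_grad b z \<bullet> v > 0"
  by (simp add: positive_timelike_def timelike_saddle df_saddle)

lemma negative_timelike_saddle:
  "negative_timelike (saddle b) 2 z v \<longleftrightarrow>
    (norm (saddle_grad b z))\<^sup>2 * (norm v)\<^sup>2 < 2 * (saddle_grad b z \<bullet> v)\<^sup>2 \<and> saddle_grad b z \<bullet> v < 0"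
  by (simp add: negative_timelike_def timelike_saddle df_saddle)

lemma timelike_saddle_regular:
  assumes "timelike (saddle b) 2 z v"
  shows "\<not> critical_point (saddle b) z \<and> v \<noteq> 0"
  using assms unfolding timelike_saddle critical_point_saddle by (intro conjI notI) simp_all

lemma positive_timelike_saddle_scaleR:
  assumes "positive_timelike (saddle b) 2 z v" "0 < a"
  shows "positive_timelike (saddle b) 2 z (a *\<^sub>R v)"
proof -
  let ?g = "saddle_grad b z"
  have "a\<^sup>2 * ((norm ?g)\<^sup>2 * (norm v)\<^sup>2) < a\<^sup>2 * (2 * (?g \<bullet> v)\<^sup>2)"
    using assms by (intro mult_strict_left_mono) (auto simp: positive_timelike_saddle)
  then show ?thesis
    using assms by (simp add: positive_timelike_saddle power_mult_distrib mult_ac)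
qed

lemma open_positive_timelike_saddle: "open {(z, v). positive_timelike (saddle b) 2 z v}"
  unfolding positive_timelike_saddle norm_real4_sq inner_real4 saddle_grad_def vector_4 case_prod_beta
  by (intro open_Collect_conj open_Collect_less continuous_intros)

text \<open>
  If \<open>v\<close> encloses an angle of less than \<open>\<pi>/4\<close> with \<open>g\<close>, and \<open>n\<close> one of at most \<open>\<pi>/4\<close>, then \<open>n\<close> and \<open>v\<close>
  enclose less than a right angle. This is the test for a function, with gradient \<open>n\<close>, to be
  monotone along timelike curves. The vectors \<open>x\<close> and \<open>y\<close> of the proof are the components of \<open>n\<close>
  and \<open>v\<close> orthogonal to \<open>g\<close>, scaled by \<open>g \<bullet> g\<close>; by Cauchy--Schwarz they are too short to
  outweigh the components along \<open>g\<close>.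
\<close>

lemma cone_duality:
  fixes g v n :: "'a::real_inner"
  assumes v: "(norm g)\<^sup>2 * (norm v)\<^sup>2 < 2 * (g \<bullet> v)\<^sup>2" "g \<bullet> v > 0"
    and n: "(norm g)\<^sup>2 * (norm n)\<^sup>2 \<le> 2 * (g \<bullet> n)\<^sup>2" "g \<bullet> n > 0"
  shows "n \<bullet> v > 0"
proof (rule ccontr)
  assume "\<not> n \<bullet> v > 0"
  define G where "G = g \<bullet> g"
  have G: "G > 0" using v(2) by (auto simp: G_def)
  define x where "x = G *\<^sub>R n - (g \<bullet> n) *\<^sub>R g"
  define y where "y = G *\<^sub>R v - (g \<bullet> v) *\<^sub>R g"
  have xy: "x \<bullet> y = G * (G * (n \<bullet> v)) - G * ((g \<bullet> n) * (g \<bullet> v))"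
    by (simp add: x_def y_def inner_diff_left inner_diff_right inner_commute[of n g] inner_commute[of v g] G_def[symmetric]
        right_diff_distrib)
  have xx: "x \<bullet> x = G * (G * (n \<bullet> n) - (g \<bullet> n)\<^sup>2)"
    by (simp add: x_def inner_diff_left inner_diff_right inner_commute[of n g] inner_commute[of v g] G_def[symmetric]
        algebra_simps power2_eq_square)
  have yy: "y \<bullet> y = G * (G * (v \<bullet> v) - (g \<bullet> v)\<^sup>2)"
    by (simp add: y_def inner_diff_left inner_diff_right inner_commute[of n g] inner_commute[of v g] G_def[symmetric]
        algebra_simps power2_eq_square)
  have x_le: "x \<bullet> x \<le> G * (g \<bullet> n)\<^sup>2"
    unfolding xx using n(1) G by (intro mult_left_mono) (auto simp: G_def power2_norm_eq_inner)
  have y_less: "y \<bullet> y < G * (g \<bullet> v)\<^sup>2"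
    unfolding yy using v(1) G by (intro mult_strict_left_mono) (auto simp: G_def power2_norm_eq_inner)
  have "G * ((g \<bullet> n) * (g \<bullet> v)) \<le> - (x \<bullet> y)"
    unfolding xy using \<open>\<not> n \<bullet> v > 0\<close> G by (simp add: mult_nonneg_nonpos)
  then have "(G * ((g \<bullet> n) * (g \<bullet> v)))\<^sup>2 \<le> (- (x \<bullet> y))\<^sup>2"
    using G v(2) n(2) by (intro power_mono) auto
  also have "\<dots> \<le> (x \<bullet> x) * (y \<bullet> y)"
    using Cauchy_Schwarz_ineq[of x y] by simp
  also have "\<dots> \<le> (G * (g \<bullet> n)\<^sup>2) * (y \<bullet> y)"
    using x_le by (intro mult_right_mono) auto
  also have "\<dots> < (G * (g \<bullet> n)\<^sup>2) * (G * (g \<bullet> v)\<^sup>2)"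
    using y_less G n(2) by (intro mult_strict_left_mono) auto
  finally show False by (simp add: power2_eq_square mult_ac)
qed

section \<open>The future of \<open>p\<close> lies in the future of \<open>q\<close>\<close>

text \<open>
  For planar vectors, \<open>|g|\<^sup>2 |v|\<^sup>2\<close> is the sum of the squares of the inner product and of the
  determinant of \<open>g\<close> and \<open>v\<close>, so the cone of half-angle \<open>\<pi>/4\<close> is where the former exceeds the
  absolute value of the latter.
\<close>

lemma planar_positive_timelike:
  assumes "z$2 = 0" "z$4 = 0" "v$2 = 0" "v$4 = 0"
    and "\<bar>z$1 * v$3 + z$3 * v$1\<bar> < z$3 * v$3 - z$1 * v$1"
  shows "positive_timelike (saddle b) 2 z v"
proof -
  have dot: "saddle_grad b z \<bullet> v = z$3 * v$3 - z$1 * v$1"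
    using assms by (simp add: inner_real4 saddle_grad_def)
  have "(norm (saddle_grad b z))\<^sup>2 * (norm v)\<^sup>2
      = (z$3 * v$3 - z$1 * v$1)\<^sup>2 + (z$1 * v$3 + z$3 * v$1)\<^sup>2"
    unfolding norm_real4_sq saddle_grad_def vector_4 assms(1-4)
    by (simp add: algebra_simps power2_eq_square)
  moreover have "(z$1 * v$3 + z$3 * v$1)\<^sup>2 < (z$3 * v$3 - z$1 * v$1)\<^sup>2"
    using power_strict_mono[OF assms(5), of 2] by simp
  ultimately show ?thesis
    using assms(5) by (simp add: positive_timelike_saddle dot)
qed

definition pt_p :: "real^4" where "pt_p = vector [- (sqrt 2 - 1), 0, 1, 0]"
definition pt_q :: "real^4" where "pt_q = vector [sqrt 2 + 1, 0, 1, 0]"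

text \<open>
  In the orthogonal coordinates \<open>(\<xi>, s)\<close> belonging to the basis \<open>q, p\<close>, the null coordinate \<open>f + x y\<close>
  is a positive multiple of \<open>\<xi> s\<close>, and \<open>f - x y\<close> is a combination of \<open>s\<^sup>2\<close> and \<open>- \<xi>\<^sup>2\<close> with positive coefficients.
  On the hyperbola \<open>\<xi> = c / (s + c)\<close> the product \<open>\<xi> s = c s / (s + c)\<close> increases with \<open>s\<close> and \<open>\<xi>\<close>
  decreases, so both null coordinates increase.
\<close>

lemma hyperbola_joins:
  assumes c: "c > 0"
  shows "joined_by_piece (saddle b) (positive_timelike (saddle b) 2) pt_q (pt_p + (c / (1 + c)) *\<^sub>R pt_q)"
proof -
  let ?z = "\<lambda>s. (c / (s + c)) *\<^sub>R pt_q + s *\<^sub>R pt_p"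
  let ?v = "\<lambda>s. - (c / (s + c)\<^sup>2) *\<^sub>R pt_q + pt_p"
  have "joined_by_piece (saddle b) (positive_timelike (saddle b) 2) (?z 0) (?z 1)"
  proof (rule joined_by_differentiable_curve[where \<gamma>' = ?v])
    fix s :: real assume s: "s \<in> {0..1}"
    then have pos: "s + c > 0" using c by simp
    then show "(?z has_vector_derivative ?v s) (at s within {0..1})"
      by (auto intro!: derivative_eq_intros simp: power2_eq_square divide_inverse)
    define \<xi> where "\<xi> = c / (s + c)"
    define \<kappa> where "\<kappa> = c / (s + c)\<^sup>2"
    have \<xi>: "\<xi> > 0" "\<kappa> > 0" using c pos by (auto simp: \<xi>_def \<kappa>_def)
    have "\<kappa> * (s + c) = \<xi>" using pos by (simp add: \<xi>_def \<kappa>_def power2_eq_square)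
    then have less: "s * \<kappa> < \<xi>" using \<xi> c by (simp add: algebra_simps flip: \<open>\<kappa> * (s + c) = \<xi>\<close>)
    have "1 + sqrt 2 > 0" by (simp add: add_pos_nonneg)
    \<comment> \<open>\<open>\<kappa>\<close> is the rate at which \<open>\<xi>\<close> decreases, and \<open>m\<close>, \<open>- l\<close> are the first coordinates of \<open>q\<close>, \<open>p\<close>.\<close>
    define m where "m = sqrt 2 + 1"
    define l where "l = sqrt 2 - 1"
    have ml: "m = l + 2" "m * m = 2 * m + 1" "l * l = 1 - 2 * l" "m * l = 1" "m > 0" "l > 0"
      unfolding m_def l_def using \<open>1 + sqrt 2 > 0\<close>
      by (simp_all add: algebra_simps)
    have comp: "?z s $ 1 = m * \<xi> - l * s" "?z s $ 2 = 0" "?z s $ 3 = \<xi> + s" "?z s $ 4 = 0"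
      "?v s $ 1 = - (m * \<kappa>) - l" "?v s $ 2 = 0" "?v s $ 3 = 1 - \<kappa>" "?v s $ 4 = 0"
      by (simp_all add: pt_p_def pt_q_def m_def l_def \<xi>_def \<kappa>_def algebra_simps)
    \<comment> \<open>The sum and the difference of \<open>dot\<close> and \<open>cross\<close> are the rates of the two null coordinates.\<close>
    have cross: "(m * \<xi> - l * s) * (1 - \<kappa>) + (\<xi> + s) * (- (m * \<kappa>) - l)
        = 2 * (\<xi> - s * \<kappa>) - 2 * (m * \<xi> * \<kappa> + l * s)"
      using ml(1) by (simp add: algebra_simps)
    have "(\<xi> + s) * (1 - \<kappa>) - (m * \<xi> - l * s) * (- (m * \<kappa>) - l)
        = \<xi> + s - \<xi> * \<kappa> - s * \<kappa> + (m * m) * \<xi> * \<kappa> + (m * l) * \<xi> - (m * l) * s * \<kappa> - (l * l) * s"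
      by (simp add: algebra_simps)
    also have "\<dots> = 2 * (\<xi> - s * \<kappa>) + 2 * (m * \<xi> * \<kappa> + l * s)"
      unfolding ml(2-4) by (simp add: algebra_simps)
    finally have dot: "(\<xi> + s) * (1 - \<kappa>) - (m * \<xi> - l * s) * (- (m * \<kappa>) - l)
        = 2 * (\<xi> - s * \<kappa>) + 2 * (m * \<xi> * \<kappa> + l * s)" .
    have "m * \<xi> * \<kappa> + l * s > 0"
      using ml \<xi> s by (intro add_pos_nonneg) auto
    then have "\<bar>2 * (\<xi> - s * \<kappa>) - 2 * (m * \<xi> * \<kappa> + l * s)\<bar>
        < 2 * (\<xi> - s * \<kappa>) + 2 * (m * \<xi> * \<kappa> + l * s)"
      using less by argo
    then show "positive_timelike (saddle b) 2 (?z s) (?v s)"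
      by (intro planar_positive_timelike) (unfold comp cross dot, (rule refl | assumption)+)
  next
    show "continuous_on {0..1} ?v"
      using c by (auto intro!: continuous_intros)
  qed (use timelike_saddle_regular in \<open>auto simp: positive_timelike_def\<close>)
  then show ?thesis using c by (simp add: add.commute)
qed

lemma not_critical_pt_p: "\<not> critical_point (saddle b) pt_p"
proof -
  have "saddle_grad b pt_p $ 3 = 1" by (simp add: saddle_grad_def pt_p_def)
  then show ?thesis unfolding critical_point_saddle by auto
qed

text \<open>
  The first piece from \<open>p\<close> ends at some \<open>z\<close> whose past is a neighbourhood of \<open>p\<close>; an arc with
  small \<open>c\<close> brings \<open>q\<close> into that neighbourhood.
\<close>

lemma future_subset: "chron_future (saddle b) 2 pt_p \<subseteq> chron_future (saddle b) 2 pt_q"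
proof
  let ?J = "joined_by_piece (saddle b) (positive_timelike (saddle b) 2)"
  fix w assume "w \<in> chron_future (saddle b) 2 pt_p"
  then have "?J\<^sup>+\<^sup>+ pt_p w" by (simp add: chron_future_eq)
  then obtain z where z: "?J pt_p z" "?J\<^sup>*\<^sup>* z w" by (meson tranclpD)
  have "\<exists>r>0. \<forall>x\<in>ball pt_p r. ?J\<^sup>+\<^sup>+ x z"
    by (rule past_is_neighbourhood[OF z(1) not_critical_pt_p open_positive_timelike_saddle])
      (auto simp: positive_timelike_def dest: timelike_saddle_regular
        intro: positive_timelike_saddle_scaleR[unfolded positive_timelike_def, THEN conjunct1]
          positive_timelike_saddle_scaleR[unfolded positive_timelike_def, THEN conjunct2])
  then obtain r where r: "r > 0" "\<And>x. x \<in> ball pt_p r \<Longrightarrow> ?J\<^sup>+\<^sup>+ x z" by blast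
  have "((\<lambda>c. pt_p + (c / (1 + c)) *\<^sub>R pt_q) \<longlongrightarrow> pt_p + (0 / (1 + 0)) *\<^sub>R pt_q) (at_right 0)"
    by (intro tendsto_intros) auto
  then have "\<forall>\<^sub>F c in at_right 0. dist (pt_p + (c / (1 + c)) *\<^sub>R pt_q) pt_p < r"
    using tendstoD r(1) by fastforce
  moreover have "\<forall>\<^sub>F c::real in at_right 0. c > 0"
    by (simp add: eventually_at_filter)
  ultimately have "\<forall>\<^sub>F c in at_right 0. dist (pt_p + (c / (1 + c)) *\<^sub>R pt_q) pt_p < r \<and> c > 0"
    by (rule eventually_conj)
  then obtain c where c: "dist (pt_p + (c / (1 + c)) *\<^sub>R pt_q) pt_p < r" "c > 0"
    using eventually_happens'[OF trivial_limit_at_right_real] by blast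
  have "?J\<^sup>+\<^sup>+ (pt_p + (c / (1 + c)) *\<^sub>R pt_q) z"
    by (rule r(2)) (use c in \<open>simp add: dist_commute\<close>)
  then have "?J\<^sup>+\<^sup>+ pt_q z"
    using hyperbola_joins[OF c(2)] by (rule tranclp_into_tranclp2[rotated])
  then show "w \<in> chron_future (saddle b) 2 pt_q"
    using z(2) by (simp add: chron_future_eq tranclp_rtranclp_tranclp)
qed

section \<open>The past of \<open>q\<close> does not lie in the past of \<open>p\<close>\<close>

text \<open>
  In the plane \<open>x\<^sub>2 = y\<^sub>2 = 0\<close> this is the null coordinate vanishing along the null lines through
  \<open>q\<close>, the critical point and \<open>p\<close>.
\<close>

definition null_coord :: "real \<Rightarrow> real^4 \<Rightarrow> real"
  where "null_coord b z = saddle b z + z$1 * z$3"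

definition x2_cone_form :: "real \<Rightarrow> real^4 \<Rightarrow> real"
  where "x2_cone_form b z = b * (z$2)\<^sup>2 - ((z$1)\<^sup>2 + (z$3)\<^sup>2 + (z$4)\<^sup>2)"

lemma null_coord_has_derivative:
  "(null_coord b has_derivative (\<lambda>v. vector [z$3 - z$1, - b * z$2, z$1 + z$3, z$4] \<bullet> v)) (at z)"
  unfolding null_coord_def saddle_def
  by (auto intro!: derivative_eq_intros simp: fun_eq_iff inner_real4 algebra_simps)

lemma x2_cone_form_has_derivative:
  "(x2_cone_form b has_derivative (\<lambda>v. (2 *\<^sub>R vector [- (z$1), b * z$2, - (z$3), - (z$4)]) \<bullet> v)) (at z)"
  unfolding x2_cone_form_def
  by (auto intro!: derivative_eq_intros simp: fun_eq_iff inner_real4 algebra_simps)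

text \<open>
  The gradient of \<open>x\<^sub>1 y\<^sub>1\<close> is orthogonal to that of \<open>f\<close> and at most as long, whatever the value of
  \<open>b\<close>; hence \<open>g \<bullet> n = |g|\<^sup>2\<close> and \<open>|n|\<^sup>2 \<le> 2 |g|\<^sup>2\<close> below.
\<close>

lemma null_coord_decreases:
  assumes "negative_timelike (saddle b) 2 z v"
  shows "vector [z$3 - z$1, - b * z$2, z$1 + z$3, z$4] \<bullet> v < 0"
proof -
  let ?g = "saddle_grad b z" and ?n = "vector [z$3 - z$1, - b * z$2, z$1 + z$3, z$4] :: real^4"
  have gn: "?g \<bullet> ?n = (norm ?g)\<^sup>2"
    unfolding inner_real4 norm_real4_sq saddle_grad_def vector_4
    by (simp add: power2_eq_square algebra_simps)
  have "2 * (norm ?g)\<^sup>2 - (norm ?n)\<^sup>2 = (b * z$2)\<^sup>2 + (z$4)\<^sup>2"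
    unfolding norm_real4_sq saddle_grad_def vector_4
    by (simp add: power2_eq_square algebra_simps)
  moreover have "\<dots> \<ge> 0" by simp
  ultimately have "(norm ?n)\<^sup>2 \<le> 2 * (norm ?g)\<^sup>2" by argo
  then have "(norm ?g)\<^sup>2 * (norm ?n)\<^sup>2 \<le> (norm ?g)\<^sup>2 * (2 * (norm ?g)\<^sup>2)"
    by (intro mult_left_mono) simp_all
  then have n_cone: "(norm ?g)\<^sup>2 * (norm ?n)\<^sup>2 \<le> 2 * (?g \<bullet> ?n)\<^sup>2"
    unfolding gn by (simp add: power2_eq_square mult_ac)
  have "?g \<noteq> 0" using assms unfolding negative_timelike_saddle by (intro notI) simp
  then have n_pos: "?g \<bullet> ?n > 0" unfolding gn by simp
  have "(norm ?g)\<^sup>2 * (norm (- v))\<^sup>2 < 2 * (?g \<bullet> (- v))\<^sup>2" "?g \<bullet> (- v) > 0"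
    using assms unfolding negative_timelike_saddle inner_minus_right norm_minus_cancel power2_minus
    by simp_all
  then have "?n \<bullet> (- v) > 0" using n_cone n_pos by (rule cone_duality)
  then show ?thesis unfolding inner_minus_right by (rule neg_0_less_iff_less[THEN iffD1])
qed

text \<open>
  Half the gradient \<open>n\<close> of the form and the downward gradient \<open>- g\<close> of \<open>f\<close> differ only in the sign of
  the first coordinate. They have the same length, and their inner product is
  \<open>|g|\<^sup>2 - 2 x\<^sub>1\<^sup>2\<close>. In the cone, \<open>x\<^sub>1\<^sup>2\<close> is less than \<open>|g|\<^sup>2 / (1 + b)\<close>, and \<open>b > 6\<close> makes the cosine of
  their angle at least \<open>5/7\<close>, which exceeds \<open>1 / sqrt 2\<close>.
\<close>

lemma x2_cone_form_increases:
  assumes "negative_timelike (saddle b) 2 z v" "b > 6" "x2_cone_form b z > 0"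
  shows "(2 *\<^sub>R vector [- (z$1), b * z$2, - (z$3), - (z$4)]) \<bullet> v > 0"
proof -
  let ?g = "saddle_grad b z" and ?n = "vector [- (z$1), b * z$2, - (z$3), - (z$4)] :: real^4"
  define S where "S = (norm ?g)\<^sup>2"
  define m where "m = (- ?g) \<bullet> ?n"
  have S: "S = (z$1)\<^sup>2 + b\<^sup>2 * (z$2)\<^sup>2 + (z$3)\<^sup>2 + (z$4)\<^sup>2"
    by (simp add: S_def norm_real4_sq saddle_grad_def power_mult_distrib)
  have n: "(norm ?n)\<^sup>2 = S"
    unfolding S by (simp add: norm_real4_sq power_mult_distrib)
  have m: "m = S - 2 * (z$1)\<^sup>2"
    unfolding S m_def by (simp add: inner_real4 saddle_grad_def power2_eq_square)
  have "S > 0" using assms(1) by (auto simp: S_def negative_timelike_saddle)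
  have "7 * (z$1)\<^sup>2 \<le> S"
  proof -
    have "6 * ((z$1)\<^sup>2 + (z$3)\<^sup>2 + (z$4)\<^sup>2) \<le> b * (b * (z$2)\<^sup>2)"
      using assms by (intro mult_mono) (auto simp: x2_cone_form_def)
    also have "b * (b * (z$2)\<^sup>2) = S - ((z$1)\<^sup>2 + (z$3)\<^sup>2 + (z$4)\<^sup>2)"
      unfolding S by (simp add: power2_eq_square)
    finally have "7 * ((z$1)\<^sup>2 + (z$3)\<^sup>2 + (z$4)\<^sup>2) \<le> S" by simp
    moreover have "(z$1)\<^sup>2 \<le> (z$1)\<^sup>2 + (z$3)\<^sup>2 + (z$4)\<^sup>2" by simp
    ultimately show ?thesis by argo
  qed
  then have "5 * S \<le> 7 * m" unfolding m by simp
  then have "m > 0" using \<open>S > 0\<close> by argo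
  have "(5 * S)\<^sup>2 \<le> (7 * m)\<^sup>2"
    using \<open>5 * S \<le> 7 * m\<close> \<open>S > 0\<close> by (intro power_mono) simp_all
  then have "25 * S\<^sup>2 \<le> 49 * m\<^sup>2" by (simp add: power_mult_distrib)
  then have "S\<^sup>2 \<le> 2 * m\<^sup>2" using zero_le_power2[of m] by argo
  then have n_cone: "(norm (- ?g))\<^sup>2 * (norm ?n)\<^sup>2 \<le> 2 * (- ?g \<bullet> ?n)\<^sup>2"
    unfolding norm_minus_cancel S_def[symmetric] n m_def[symmetric] by (simp add: power2_eq_square)
  have n_pos: "- ?g \<bullet> ?n > 0" using \<open>m > 0\<close> by (simp only: m_def)
  have "(norm (- ?g))\<^sup>2 * (norm v)\<^sup>2 < 2 * (- ?g \<bullet> v)\<^sup>2" "- ?g \<bullet> v > 0"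
    using assms(1) unfolding negative_timelike_saddle inner_minus_left norm_minus_cancel power2_minus
    by simp_all
  then have "?n \<bullet> v > 0" using n_cone n_pos by (rule cone_duality)
  then show ?thesis unfolding inner_scaleR_left by (rule mult_pos_pos[OF zero_less_numeral])
qed

text \<open>
  A piece ending at \<open>x\<^sub>1 \<ge> 0\<close> has been in the cone at some time: at its start, or where it crosses
  \<open>x\<^sub>1 = 0\<close>, because there the null coordinate equals \<open>f\<close>, whose negativity means membership in the
  cone. From then on it stays inside. The initial null coordinate may be \<open>0\<close>, as it is at \<open>p\<close>.
\<close>

lemma past_trapped_step:
  assumes b: "b > 6" and J: "joined_by_piece (saddle b) (negative_timelike (saddle b) 2) z w"
    and z: "null_coord b z \<le> 0" "z$1 < 0 \<or> x2_cone_form b z > 0"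
  shows "null_coord b w < 0 \<and> (w$1 < 0 \<or> x2_cone_form b w > 0)"
proof -
  from J obtain \<gamma> s t where \<gamma>: "curve_piece (saddle b) (negative_timelike (saddle b) 2) \<gamma> s t"
    "\<gamma> s = z" "\<gamma> t = w"
    unfolding joined_by_piece_def by blast
  have "s < t" and co: "continuous_on {s..t} \<gamma>" using \<gamma>(1) by (auto simp: curve_piece_def)
  have co1: "continuous_on {s..t} (\<lambda>u. \<gamma> u $ 1)"
    and co_null: "continuous_on {s..t} (\<lambda>u. null_coord b (\<gamma> u))"
    and co_cone: "continuous_on {s..t} (\<lambda>u. x2_cone_form b (\<gamma> u))"
    unfolding null_coord_def x2_cone_form_def saddle_def by (intro continuous_intros co)+
  have neg: "null_coord b (\<gamma> u) < 0" if "s < u" "u \<le> t" for u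
  proof -
    have "- null_coord b (\<gamma> s) < - null_coord b (\<gamma> u)"
    proof (rule DERIV_pos_imp_increasing_open[OF \<open>s < u\<close>])
      fix x assume x: "s < x" "x < u"
      then have "x \<in> {s<..<t}" using that by simp
      then obtain v where "negative_timelike (saddle b) 2 (\<gamma> x) v"
        and "((\<lambda>u. null_coord b (\<gamma> u)) has_real_derivative
          vector [\<gamma> x$3 - \<gamma> x$1, - b * \<gamma> x$2, \<gamma> x$1 + \<gamma> x$3, \<gamma> x$4] \<bullet> v) (at x)"
        using curve_piece_has_real_derivative[OF \<gamma>(1) _ null_coord_has_derivative] by blast
      then show "\<exists>y. ((\<lambda>u. - null_coord b (\<gamma> u)) has_real_derivative y) (at x) \<and> y > 0"
        using null_coord_decreases DERIV_minus neg_0_less_iff_less by blast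
    next
      show "continuous_on {s..u} (\<lambda>u. - null_coord b (\<gamma> u))"
        by (intro continuous_intros continuous_on_subset[OF co_null]) (use that in auto)
    qed
    then show ?thesis using z(1) \<gamma>(2) by simp
  qed
  moreover have "x2_cone_form b w > 0" if "\<not> w$1 < 0"
  proof -
    have "\<exists>\<tau>\<in>{s..t}. x2_cone_form b (\<gamma> \<tau>) > 0"
    proof (cases "z$1 < 0")
      case True
      have "\<exists>\<tau>\<ge>s. \<tau> \<le> t \<and> \<gamma> \<tau> $ 1 = 0"
        by (rule IVT'[OF _ _ _ co1]) (use True that \<gamma> \<open>s < t\<close> in auto)
      then obtain \<tau> where \<tau>: "s \<le> \<tau>" "\<tau> \<le> t" "\<gamma> \<tau> $ 1 = 0" by blast
      then have "s < \<tau>" using True \<gamma>(2) by (cases "s = \<tau>") auto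
      then have "null_coord b (\<gamma> \<tau>) < 0" using neg \<tau> by simp
      then have "x2_cone_form b (\<gamma> \<tau>) > 0" using \<tau>(3) by (simp add: null_coord_def x2_cone_form_def saddle_def)
      then show ?thesis using \<tau> by auto
    next
      case False
      then show ?thesis using z(2) \<gamma>(2) \<open>s < t\<close> by (intro bexI[of _ s]) auto
    qed
    then obtain \<tau> where \<tau>: "s \<le> \<tau>" "\<tau> \<le> t" "x2_cone_form b (\<gamma> \<tau>) > 0" by auto
    have "x2_cone_form b (\<gamma> t) > 0"
    proof (rule positive_if_increasing_where_positive[OF \<tau>(2)])
      show "continuous_on {\<tau>..t} (\<lambda>u. x2_cone_form b (\<gamma> u))"
        by (rule continuous_on_subset[OF co_cone]) (use \<tau> in auto)
      show "x2_cone_form b (\<gamma> \<tau>) > 0" by (rule \<tau>(3))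
      fix x assume x: "\<tau> < x" "x < t" "x2_cone_form b (\<gamma> x) > 0"
      then have "x \<in> {s<..<t}" using \<tau> by simp
      then obtain v where "negative_timelike (saddle b) 2 (\<gamma> x) v"
        and "((\<lambda>u. x2_cone_form b (\<gamma> u)) has_real_derivative
          (2 *\<^sub>R vector [- (\<gamma> x$1), b * \<gamma> x$2, - (\<gamma> x$3), - (\<gamma> x$4)]) \<bullet> v) (at x)"
        using curve_piece_has_real_derivative[OF \<gamma>(1) _ x2_cone_form_has_derivative] by blast
      then show "\<exists>d. ((\<lambda>u. x2_cone_form b (\<gamma> u)) has_real_derivative d) (at x) \<and> d > 0"
        using x2_cone_form_increases b x(3) by blast
    qed
    then show ?thesis by (simp add: \<gamma>(3))
  qed
  ultimately show ?thesis using \<open>s < t\<close> \<gamma>(3) by blast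
qed

lemma past_trapped:
  assumes b: "b > 6" and "w \<in> chron_past (saddle b) 2 pt_p"
  shows "w$1 < 0 \<or> x2_cone_form b w > 0"
proof -
  have "(joined_by_piece (saddle b) (negative_timelike (saddle b) 2))\<^sup>+\<^sup>+ pt_p w"
    using assms(2) by (simp add: chron_past_eq)
  then have "null_coord b w < 0 \<and> (w$1 < 0 \<or> x2_cone_form b w > 0)"
  proof (induction rule: tranclp_induct)
    case (base w)
    have "null_coord b pt_p = 0" "pt_p $ 1 < 0"
      by (simp_all add: pt_p_def null_coord_def saddle_def power2_eq_square algebra_simps)
    then show ?case using past_trapped_step[OF b base] by simp
  next
    case (step w x)
    then show ?case using past_trapped_step[OF b step.hyps(2)] by simp
  qed
  then show ?thesis by simp
qed

text \<open>
  At \<open>q\<close> the \<open>x\<^sub>1\<close>-axis is \<open>\<pi>/8\<close> away from the downward gradient of \<open>f\<close>, and the angle only shrinks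
  as \<open>x\<^sub>1\<close> grows.
\<close>

lemma past_of_q: "pt_q + axis 1 1 \<in> chron_past (saddle b) 2 pt_q"
proof -
  have "joined_by_piece (saddle b) (negative_timelike (saddle b) 2)
      (pt_q + 0 *\<^sub>R axis 1 1) (pt_q + 1 *\<^sub>R axis 1 1)"
  proof (rule joined_by_differentiable_curve[where \<gamma>' = "\<lambda>_. axis 1 1"])
    fix s :: real assume s: "s \<in> {0..1}"
    define x where "x = sqrt 2 + 1 + s"
    have "x > 1" using s unfolding x_def by (auto intro: add_pos_nonneg)
    then have "1\<^sup>2 < x\<^sup>2" by (intro power_strict_mono) simp_all
    moreover have "pt_q + s *\<^sub>R axis 1 1 = vector [x, 0, 1, 0]"
      by (simp add: vec_eq_iff forall_4 pt_q_def axis_def x_def)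
    ultimately show "negative_timelike (saddle b) 2 (pt_q + s *\<^sub>R axis 1 1) (axis 1 1)"
      using \<open>x > 1\<close>
      by (simp add: negative_timelike_saddle norm_real4_sq inner_real4 saddle_grad_def axis_def)
  qed (use timelike_saddle_regular in
      \<open>auto intro!: derivative_eq_intros simp: negative_timelike_def\<close>)
  then show ?thesis by (auto simp: chron_past_eq)
qed

lemma past_not_subset:
  assumes "b > 6"
  shows "\<not> chron_past (saddle b) 2 pt_q \<subseteq> chron_past (saddle b) 2 pt_p"
proof
  assume "chron_past (saddle b) 2 pt_q \<subseteq> chron_past (saddle b) 2 pt_p"
  then have "(pt_q + axis 1 1) $ 1 < 0 \<or> x2_cone_form b (pt_q + axis 1 1) > 0"
    using past_of_q past_trapped[OF assms] by blast
  moreover have "(pt_q + axis 1 1) $ 1 \<ge> 0"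
    by (simp add: pt_q_def axis_def)
  moreover have "x2_cone_form b (pt_q + axis 1 1) = - ((sqrt 2 + 2)\<^sup>2 + 1)"
    by (simp add: pt_q_def axis_def x2_cone_form_def add.commute)
  ultimately show False using zero_le_power2[of "sqrt 2 + 2"] by linarith
qed

theorem theorem1:
  shows "\<exists>b0::real. b0 > 0 \<and> (\<forall>b>b0.
    \<not> causally_continuous (saddle b) 2 \<and>
    points_of_causal_discontinuity (saddle b) 2
      (vector [- (sqrt 2 - 1), 0, 1, 0]) (vector [sqrt 2 + 1, 0, 1, 0]))"
proof (intro exI[of _ 6] conjI allI impI)
  fix b :: real assume "b > 6"
  then have "points_of_causal_discontinuity (saddle b) 2 pt_p pt_q"
    unfolding points_of_causal_discontinuity_def
    using future_subset past_not_subset by blast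
  then show "points_of_causal_discontinuity (saddle b) 2
      (vector [- (sqrt 2 - 1), 0, 1, 0]) (vector [sqrt 2 + 1, 0, 1, 0])"
    unfolding pt_p_def pt_q_def .
  then show "\<not> causally_continuous (saddle b) 2"
    unfolding causally_continuous_def reflecting_def points_of_causal_discontinuity_def by blast
qed simp

end
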